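(* Let $c<d$ be real numbers and let $\ell\ge 1$. Let $\mathcal{X}_1,\dots,\mathcal{X}_\ell\in\mathscr{A}(\mathfrak{H})$ be Hermitian tensors all of whose eigenvalues lie in $[c,d]$, let $\Psi_1,\dots,\Psi_\ell:\mathscr{A}(\mathfrak{H})\to\mathscr{A}(\mathfrak{K})$ be normalized positive linear maps for tensors, and let $(w_1,\dots,w_\ell)$ be a probability vector, i.e. $w_i\ge 0$ for all $i$ and $\sum_{i=1}^\ell w_i=1$. Let $g,h$ be continuous real functions on $[c,d]$ with $g$ convex on $[c,d]$, and let $$m_g=\frac{g(d)-g(c)}{d-c},\qquad b_{g,U}=\frac{d\,g(c)-c\,g(d)}{d-c},\qquad b_{g,L}=g\left((g')^{-1}(m_g)\right)-m_g\,(g')^{-1}(m_g).$$ Assume $h(s)>0$, $m_g s+b_{g,U}>0$ and $m_g s+b_{g,L}>0$ for all $s\in[c,d]$. Then, in the Loewner order, $$\frac{1}{\max\limits_{c\le s\le d}\left[\frac{m_g s+b_{g,U}}{h(s)}\right]}\sum_{i=1}^{\ell}w_i\Psi_i(g(\mathcal{X}_i))\;\le\; h\left(\sum_{i=1}^{\ell}w_i\Psi_i(\mathcal{X}_i)\right)\;\le\;\frac{1}{\min\limits_{c\le s\le d}\left[\frac{m_g s+b_{g,L}}{h(s)}\right]}\sum_{i=1}^{\ell}w_i\Psi_i(g(\mathcal{X}_i)).$$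
   Context: Tensors are square tensors in $\mathbb{C}^{I_1\times\cdots\times I_M\times I_1\times\cdots\times I_M}$ with the Einstein product $\star$, i.e. linear operators on a finite-dimensional complex space of dimension $\prod_{i=1}^M I_i$; Hermitian tensors, eigenvalues, identity tensors, the functional calculus $g(\mathcal{X})$ for Hermitian $\mathcal{X}$, and the Loewner order $\le$ are those of the corresponding operators. $\mathscr{A}(\mathfrak{H})$ and $\mathscr{A}(\mathfrak{K})$ denote the algebras of all tensors on the finite-dimensional vector spaces $\mathfrak{H}$ and $\mathfrak{K}$, with identity tensors $\mathcal{I}_{\mathfrak{H}}$ and $\mathcal{I}_{\mathfrak{K}}$. A normalized positive linear map for tensors is a map $\Psi:\mathscr{A}(\mathfrak{H})\to\mathscr{A}(\mathfrak{K})$ that is linear over $\mathbb{C}$, satisfies $\Psi(\mathcal{I}_{\mathfrak{H}})=\mathcal{I}_{\mathfrak{K}}$ (normalized), and satisfies $\Psi(\mathcal{X})\ge\Psi(\mathcal{Y})$ whenever $\mathcal{X}\ge\mathcal{Y}$ (positive). All such maps are taken to send Hermitian tensors to Hermitian tensors. $(g')^{-1}$ is the inverse function of the first derivative $g'$; the notation presupposes that $g$ is differentiable and that $s_0=(g')^{-1}(m_g)\in[c,d]$ is the point with $g'(s_0)=m_g$. *)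

theory Defs
  imports "HOL-Analysis.Analysis"
begin

text \<open>
  A square tensor in \<open>\<complex>\<^bsup>I\<^sub>1 \<times> \<dots> \<times> I\<^sub>M \<times> I\<^sub>1 \<times> \<dots> \<times> I\<^sub>M\<^esup>\<close> is an array
  \<open>A $ i $ j\<close> whose row and column indices \<open>i, j\<close> are multi-indices. The finite type
  \<open>'n\<close> is the type of multi-indices (for instance an \<open>M\<close>-fold product of finite types), so
  that the Einstein product, which contracts over one whole multi-index, is \<open>(**)\<close>, the
  identity tensor is \<open>mat 1\<close>, and the action on the underlying space \<open>complex^'n\<close>
  is \<open>(*v)\<close>.
\<close>

type_synonym 'n tensor = "complex^'n^'n"

definition tensor_scale :: "complex \<Rightarrow> 'n::finite tensor \<Rightarrow> 'n tensor" where
  "tensor_scale a A = (\<chi> i j. a * A $ i $ j)"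

lemma vector_space_tensor_scale: "vector_space (tensor_scale :: complex \<Rightarrow> 'n::finite tensor \<Rightarrow> _)"
  by unfold_locales (simp_all add: tensor_scale_def vec_eq_iff algebra_simps)

definition tensor_adjoint :: "'n::finite tensor \<Rightarrow> 'n tensor" where
  "tensor_adjoint A = (\<chi> i j. cnj (A $ j $ i))"

definition hermitian_tensor :: "'n::finite tensor \<Rightarrow> bool" where
  "hermitian_tensor A \<longleftrightarrow> tensor_adjoint A = A"

definition unitary_tensor :: "'n::finite tensor \<Rightarrow> bool" where
  "unitary_tensor U \<longleftrightarrow> tensor_adjoint U ** U = mat 1 \<and> U ** tensor_adjoint U = mat 1"

definition tensor_eigenvalue :: "'n::finite tensor \<Rightarrow> complex \<Rightarrow> bool" where
  "tensor_eigenvalue A k \<longleftrightarrow> (\<exists>v. v \<noteq> 0 \<and> A *v v = k *s v)"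

definition hermitian_inner :: "complex^'n::finite \<Rightarrow> complex^'n \<Rightarrow> complex" where
  "hermitian_inner u v = (\<Sum>i\<in>UNIV. cnj (u $ i) * v $ i)"

text \<open>For Hermitian \<open>A\<close> the quadratic form is real-valued, so taking \<open>Re\<close> loses nothing.\<close>

definition psd_tensor :: "'n::finite tensor \<Rightarrow> bool" where
  "psd_tensor A \<longleftrightarrow> hermitian_tensor A \<and> (\<forall>v. Re (hermitian_inner v (A *v v)) \<ge> 0)"

definition loewner_le :: "'n::finite tensor \<Rightarrow> 'n tensor \<Rightarrow> bool" (infix "\<le>\<^sub>L" 50) where
  "A \<le>\<^sub>L B \<longleftrightarrow> hermitian_tensor A \<and> hermitian_tensor B \<and> psd_tensor (B - A)"

definition diag_tensor :: "('n::finite \<Rightarrow> real) \<Rightarrow> 'n tensor" where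
  "diag_tensor \<mu> = (\<chi> i j. if i = j then complex_of_real (\<mu> i) else 0)"

text \<open>
  Functional calculus through a spectral decomposition \<open>X = U D U\<^sup>*\<close>. For Hermitian \<open>X\<close> such
  a decomposition exists and \<open>U f(D) U\<^sup>*\<close> does not depend on its choice; for other
  \<open>X\<close> the value is unspecified. Only the values of \<open>f\<close> on the spectrum matter.
\<close>

definition tensor_fun :: "(real \<Rightarrow> real) \<Rightarrow> 'n::finite tensor \<Rightarrow> 'n tensor" where
  "tensor_fun f X = (THE Y. \<exists>U \<mu>. unitary_tensor U \<and>
     X = U ** diag_tensor \<mu> ** tensor_adjoint U \<and>
     Y = U ** diag_tensor (\<lambda>i. f (\<mu> i)) ** tensor_adjoint U)"

definition normalized_positive_linear_map :: "('n::finite tensor \<Rightarrow> 'k::finite tensor) \<Rightarrow> bool" where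
  "normalized_positive_linear_map \<Psi> \<longleftrightarrow>
     Vector_Spaces.linear tensor_scale tensor_scale \<Psi> \<and>
     \<Psi> (mat 1) = mat 1 \<and>
     (\<forall>X Y. Y \<le>\<^sub>L X \<longrightarrow> \<Psi> Y \<le>\<^sub>L \<Psi> X) \<and>
     (\<forall>X. hermitian_tensor X \<longrightarrow> hermitian_tensor (\<Psi> X))"

definition chord_slope :: "(real \<Rightarrow> real) \<Rightarrow> real \<Rightarrow> real \<Rightarrow> real" where
  "chord_slope g c d = (g d - g c) / (d - c)"

definition upper_intercept :: "(real \<Rightarrow> real) \<Rightarrow> real \<Rightarrow> real \<Rightarrow> real" where
  "upper_intercept g c d = (d * g c - c * g d) / (d - c)"

text \<open>
  Here \<open>g'\<close> is the derivative of \<open>g\<close> on \<open>[c, d]\<close>. \<open>inv_into\<close> is the inverse function of \<open>g'\<close>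
  when \<open>g'\<close> is injective; otherwise it picks some \<open>s\<^sub>0\<close> in \<open>[c, d]\<close> with
  \<open>g' s\<^sub>0 = chord_slope g c d\<close>. By the mean value theorem such a point always exists.
\<close>

definition lower_intercept ::
    "(real \<Rightarrow> real) \<Rightarrow> (real \<Rightarrow> real) \<Rightarrow> real \<Rightarrow> real \<Rightarrow> real" where
  "lower_intercept g g' c d =
     g (inv_into {c..d} g' (chord_slope g c d))
       - chord_slope g c d * inv_into {c..d} g' (chord_slope g c d)"

text \<open>\<open>Max\<close> and \<open>Min\<close> are restricted to finite sets, hence \<open>Greatest\<close> and \<open>Least\<close>.\<close>

definition max_on :: "real set \<Rightarrow> (real \<Rightarrow> real) \<Rightarrow> real" where
  "max_on S f = (GREATEST y. y \<in> f ` S)"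

definition min_on :: "real set \<Rightarrow> (real \<Rightarrow> real) \<Rightarrow> real" where
  "min_on S f = (LEAST y. y \<in> f ` S)"

end

theory Submission
  imports Defs
begin

text \<open>
  The inequality is the operator form of the Mond--Pecaric method. Put
  \<open>A = \<Sum>i. w i *\<^sub>R \<Psi> i (X i)\<close> and \<open>G = \<Sum>i. w i *\<^sub>R \<Psi> i (g (X i))\<close>, and let \<open>m\<close> be the slope of the
  chord of \<open>g\<close> over \<open>[c, d]\<close>. By convexity \<open>g\<close> lies below its chord \<open>m s + b\<^sub>U\<close>
  (\<open>convex_on_below_chord\<close>) and above the parallel tangent \<open>m s + b\<^sub>L\<close>
  (\<open>convex_on_above_lower_intercept\<close>). Affine functions commute with averages of normalized
  positive maps, and inequalities between functions on the spectrum become Loewner inequalities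
  (\<open>tensor_fun_mono\<close>), so \<open>m A + b\<^sub>L \<le> G \<le> m A + b\<^sub>U\<close>.

  What remains concerns functions of the single tensor \<open>A\<close>. Its spectrum lies in \<open>[c, d]\<close>,
  because \<open>c \<le> X i \<le> d\<close> is inherited by \<open>A\<close>. With \<open>M\<close> and \<open>N\<close> the maximum and minimum in the
  statement, the scalar inequalities \<open>(m s + b\<^sub>U) / M \<le> h s \<le> (m s + b\<^sub>L) / N\<close> on \<open>[c, d]\<close> hold
  by definition, so that \<open>G / M \<le> (m A + b\<^sub>U) / M \<le> h(A) \<le> (m A + b\<^sub>L) / N \<le> G / N\<close>. The positivity
  hypotheses make \<open>M\<close> and \<open>N\<close> positive.

  The functional calculus rests on the spectral theorem. It is proved by extending an orthonormal
  system of eigenvectors one vector at a time: its orthogonal complement is invariant, and a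
  maximizer of the quadratic form on the unit sphere of the complement is a further eigenvector
  (\<open>selfadjoint_invariant_subspace_eigenvector\<close>).
\<close>

section \<open>Hermitian tensors and the Loewner order\<close>

lemma tensor_adjoint_adjoint [simp]: "tensor_adjoint (tensor_adjoint A) = A"
  by (simp add: tensor_adjoint_def vec_eq_iff)

lemma tensor_adjoint_mult: "tensor_adjoint (A ** B) = tensor_adjoint B ** tensor_adjoint A"
  by (simp add: tensor_adjoint_def matrix_matrix_mult_def vec_eq_iff mult.commute)

lemma tensor_adjoint_diag [simp]: "tensor_adjoint (diag_tensor \<mu>) = diag_tensor \<mu>"
  by (auto simp: tensor_adjoint_def diag_tensor_def vec_eq_iff)

lemma hermitian_mat_1 [simp]: "hermitian_tensor (mat 1)"
  by (auto simp: hermitian_tensor_def tensor_adjoint_def mat_def vec_eq_iff)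

lemma hermitian_0 [simp]: "hermitian_tensor 0"
  by (simp add: hermitian_tensor_def tensor_adjoint_def vec_eq_iff)

lemma hermitian_add:
  "hermitian_tensor A \<Longrightarrow> hermitian_tensor B \<Longrightarrow> hermitian_tensor (A + B)"
  by (simp add: hermitian_tensor_def tensor_adjoint_def vec_eq_iff)

lemma hermitian_diff:
  "hermitian_tensor A \<Longrightarrow> hermitian_tensor B \<Longrightarrow> hermitian_tensor (A - B)"
  by (simp add: hermitian_tensor_def tensor_adjoint_def vec_eq_iff)

lemma hermitian_scaleR: "hermitian_tensor A \<Longrightarrow> hermitian_tensor (r *\<^sub>R A)"
  by (simp add: hermitian_tensor_def tensor_adjoint_def vec_eq_iff)

lemma hermitian_sum:
  "(\<And>i. i \<in> S \<Longrightarrow> hermitian_tensor (A i)) \<Longrightarrow> hermitian_tensor (\<Sum>i\<in>S. A i)"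
  by (induction S rule: infinite_finite_induct) (auto intro: hermitian_add)

lemma hermitian_congruence_diag:
  "hermitian_tensor (U ** diag_tensor \<mu> ** tensor_adjoint U)"
  by (simp add: hermitian_tensor_def tensor_adjoint_mult matrix_mul_assoc)

text \<open>
  The real part of the Hermitian inner product is the Euclidean inner product of
  \<open>complex^'n\<close> as a real space. Loewner inequalities and the variational argument
  below can therefore be carried out in the real inner product space.
\<close>

lemma Re_hermitian_inner: "Re (hermitian_inner u v) = u \<bullet> v"
  by (simp add: hermitian_inner_def inner_vec_def inner_complex_def)

lemma hermitian_inner_adjoint:
  "hermitian_inner (A *v u) v = hermitian_inner u (tensor_adjoint A *v v)"
proof -
  have "hermitian_inner (A *v u) v = (\<Sum>i\<in>UNIV. \<Sum>j\<in>UNIV. cnj (A $ i $ j) * cnj (u $ j) * v $ i)"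
    by (simp add: hermitian_inner_def matrix_vector_mult_def sum_distrib_right)
  also have "\<dots> = (\<Sum>j\<in>UNIV. \<Sum>i\<in>UNIV. cnj (A $ i $ j) * cnj (u $ j) * v $ i)"
    by (rule sum.swap)
  also have "\<dots> = hermitian_inner u (tensor_adjoint A *v v)"
    by (simp add: hermitian_inner_def matrix_vector_mult_def tensor_adjoint_def sum_distrib_left
        mult_ac)
  finally show ?thesis .
qed

lemma inner_adjoint: "(A *v u) \<bullet> v = u \<bullet> (tensor_adjoint A *v v)" for u v :: "complex^'n"
  by (metis Re_hermitian_inner hermitian_inner_adjoint)

definition quadratic_form :: "'n::finite tensor \<Rightarrow> complex^'n \<Rightarrow> real" where
  "quadratic_form A v = v \<bullet> (A *v v)"

lemma quadratic_form_add: "quadratic_form (A + B) v = quadratic_form A v + quadratic_form B v"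
  by (simp add: quadratic_form_def matrix_vector_mult_add_rdistrib inner_add_right)

lemma quadratic_form_diff: "quadratic_form (A - B) v = quadratic_form A v - quadratic_form B v"
  by (simp add: quadratic_form_def matrix_vector_mult_diff_rdistrib inner_diff_right)

lemma quadratic_form_scaleR: "quadratic_form (r *\<^sub>R A) v = r * quadratic_form A v"
proof -
  have "(r *\<^sub>R A) *v v = r *\<^sub>R (A *v v)"
    by (simp add: matrix_vector_mult_def vec_eq_iff scaleR_sum_right)
  then show ?thesis by (simp add: quadratic_form_def)
qed

lemma quadratic_form_sum: "quadratic_form (\<Sum>i\<in>S. A i) v = (\<Sum>i\<in>S. quadratic_form (A i) v)"
  by (induction S rule: infinite_finite_induct)
    (auto simp: quadratic_form_add, auto simp: quadratic_form_def)

lemma quadratic_form_mat_1: "quadratic_form (mat 1) v = v \<bullet> v"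
  by (simp add: quadratic_form_def)

text \<open>
  Since the quadratic form is real-linear in the tensor, this criterion reduces the order rules for
  sums and scalings to those of the real numbers.
\<close>

lemma loewner_le_iff:
  "A \<le>\<^sub>L B \<longleftrightarrow> hermitian_tensor A \<and> hermitian_tensor B \<and>
     (\<forall>v. quadratic_form A v \<le> quadratic_form B v)"
  using hermitian_diff
  by (auto simp: loewner_le_def psd_tensor_def Re_hermitian_inner
      simp flip: quadratic_form_def simp: quadratic_form_diff)

lemma loewner_le_trans: "A \<le>\<^sub>L B \<Longrightarrow> B \<le>\<^sub>L C \<Longrightarrow> A \<le>\<^sub>L C"
  by (auto simp: loewner_le_iff intro: order_trans)

lemma loewner_le_scaleR: "A \<le>\<^sub>L B \<Longrightarrow> r \<ge> 0 \<Longrightarrow> r *\<^sub>R A \<le>\<^sub>L r *\<^sub>R B"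
  by (auto simp: loewner_le_iff quadratic_form_scaleR intro: hermitian_scaleR mult_left_mono)

lemma loewner_le_sum: "(\<And>i. i \<in> S \<Longrightarrow> A i \<le>\<^sub>L B i) \<Longrightarrow> (\<Sum>i\<in>S. A i) \<le>\<^sub>L (\<Sum>i\<in>S. B i)"
  by (auto simp: loewner_le_iff quadratic_form_sum intro!: hermitian_sum sum_mono)

section \<open>The spectral theorem\<close>

text \<open>
  The eigenvector is a point \<open>v\<close> of the unit sphere of \<open>W\<close> at which \<open>f v \<bullet> v\<close> is largest. If
  \<open>\<kappa>\<close> is the maximal value, the form \<open>\<kappa> * (y \<bullet> y) - f y \<bullet> y\<close> is nonnegative on \<open>W\<close> and vanishes
  at \<open>v\<close>; a nonnegative form has vanishing gradient at its zeros, and this gradient is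
  proportional to the residual \<open>\<kappa> *\<^sub>R v - f v\<close>, which itself belongs to \<open>W\<close>.
\<close>

lemma selfadjoint_invariant_subspace_eigenvector:
  fixes f :: "'a::euclidean_space \<Rightarrow> 'a"
  assumes lin: "linear f" and self: "\<And>x y. f x \<bullet> y = x \<bullet> f y"
    and W: "subspace W" "f ` W \<subseteq> W" "W \<noteq> {0}"
  obtains v \<kappa> where "v \<in> W" "norm v = 1" "f v = \<kappa> *\<^sub>R v"
proof -
  let ?K = "sphere 0 1 \<inter> W"
  obtain x where x: "x \<in> W" "x \<noteq> 0"
    using W subspace_0 by blast
  have "(1 / norm x) *\<^sub>R x \<in> ?K"
    using x W by (simp add: subspace_scale)
  then have "?K \<noteq> {}" by blast
  moreover have "compact ?K"
    by (intro compact_Int_closed closed_subspace W) simp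
  moreover have "continuous_on ?K (\<lambda>v. f v \<bullet> v)"
    using lin by (intro continuous_intros linear_continuous_on) (simp add: linear_conv_bounded_linear)
  ultimately obtain v where v: "v \<in> ?K" and max: "\<And>y. y \<in> ?K \<Longrightarrow> f y \<bullet> y \<le> f v \<bullet> v"
    using continuous_attains_sup[of ?K "\<lambda>v. f v \<bullet> v"] by blast
  define \<kappa> where "\<kappa> = f v \<bullet> v"
  have bound: "f y \<bullet> y \<le> \<kappa> * (y \<bullet> y)" if "y \<in> W" for y
  proof (cases "y = 0")
    case False
    have "(1 / norm y) *\<^sub>R y \<in> ?K"
      using False that W by (simp add: subspace_scale)
    from max[OF this] have "(f y \<bullet> y) / (norm y)\<^sup>2 \<le> \<kappa>"
      by (simp add: \<kappa>_def linear_scale[OF lin] power2_eq_square divide_inverse mult_ac)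
    then show ?thesis
      using False by (simp add: field_simps power2_norm_eq_inner)
  qed (simp add: linear_0[OF lin])
  \<comment> \<open>The residual \<open>r\<close> is itself used as the direction in which \<open>v\<close> is perturbed.\<close>
  define r where "r = \<kappa> *\<^sub>R v - f v"
  have vW: "v \<in> W" and vv: "v \<bullet> v = 1"
    using v by (auto simp: dot_square_norm)
  have rW: "r \<in> W"
    unfolding r_def using vW W by (intro subspace_diff subspace_scale) auto
  define q where "q = \<kappa> * (r \<bullet> r) - f r \<bullet> r"
  have ineq: "0 \<le> 2 * t * (r \<bullet> r) + t\<^sup>2 * q" for t
  proof -
    have "v + t *\<^sub>R r \<in> W" using vW rW W by (intro subspace_add subspace_scale)
    from bound[OF this]
    have "0 \<le> \<kappa> * ((v + t *\<^sub>R r) \<bullet> (v + t *\<^sub>R r)) - (f v + t *\<^sub>R f r) \<bullet> (v + t *\<^sub>R r)"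
      by (simp add: linear_add[OF lin] linear_scale[OF lin])
    also have "\<dots> = 2 * t * (\<kappa> * (v \<bullet> r) - f v \<bullet> r) + t\<^sup>2 * q"
      using self[of r v]
      by (simp add: q_def inner_add_left inner_add_right vv \<kappa>_def power2_eq_square
          algebra_simps inner_commute)
    also have "\<kappa> * (v \<bullet> r) - f v \<bullet> r = r \<bullet> r"
      by (simp add: r_def inner_diff_left)
    finally show ?thesis .
  qed
  have "r \<bullet> r = 0"
  proof (rule ccontr)
    assume "r \<bullet> r \<noteq> 0"
    then have pos: "r \<bullet> r > 0" by simp
    \<comment> \<open>For small negative \<open>t\<close> the linear term of \<open>ineq\<close> dominates; this \<open>t\<close> gives \<open>\<bar>t * q\<bar> < r \<bullet> r\<close>.\<close>
    define t where "t = - (r \<bullet> r) / (\<bar>q\<bar> + 1)"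
    have t: "t < 0" using pos by (simp add: t_def divide_neg_pos)
    have "- (t * q) \<le> \<bar>t\<bar> * \<bar>q\<bar>" by (metis abs_ge_minus_self abs_mult)
    also have "\<dots> < r \<bullet> r"
      using pos by (simp add: t_def divide_simps algebra_simps)
    finally have "2 * (r \<bullet> r) + t * q > 0" using pos by linarith
    then have "t * (2 * (r \<bullet> r) + t * q) < 0" using t by (simp add: mult_less_0_iff)
    then show False
      using ineq[of t] by (simp add: algebra_simps power2_eq_square)
  qed
  then have "f v = \<kappa> *\<^sub>R v" by (simp add: r_def)
  with that[of v \<kappa>] v vW show thesis by simp
qed

text \<open>
  Indexing the system by a subset of the coordinate type \<open>'n\<close> makes the system for
  \<open>UNIV\<close> directly the columns of a square tensor. The induction on this subset extends the
  system within its orthogonal complement.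
\<close>

lemma hermitian_orthonormal_eigenvectors:
  fixes A :: "'n::finite tensor" and S :: "'n set"
  assumes "hermitian_tensor A"
  shows "\<exists>u \<mu>. (\<forall>i\<in>S. A *v u i = complex_of_real (\<mu> i) *s u i) \<and>
           (\<forall>i\<in>S. \<forall>j\<in>S. hermitian_inner (u i) (u j) = (if i = j then 1 else 0))"
  using finite[of S]
proof (induction S)
  case (insert k S)
  have adj: "tensor_adjoint A = A" using assms by (simp add: hermitian_tensor_def)
  from insert.IH obtain u \<mu> where
    eig: "\<And>i. i \<in> S \<Longrightarrow> A *v u i = complex_of_real (\<mu> i) *s u i" and
    orth: "\<And>i j. i \<in> S \<Longrightarrow> j \<in> S \<Longrightarrow> hermitian_inner (u i) (u j) = (if i = j then 1 else 0)"
    by blast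
  define M :: "'n tensor" where "M = (\<chi> i j. if i \<in> S then cnj (u i $ j) else 0)"
  have M: "(M *v v) $ i = (if i \<in> S then hermitian_inner (u i) v else 0)" for v i
    by (simp add: M_def matrix_vector_mult_def hermitian_inner_def)
  define W where "W = {v. M *v v = 0}"
  have W: "v \<in> W \<longleftrightarrow> (\<forall>i\<in>S. hermitian_inner (u i) v = 0)" for v
    by (auto simp: W_def vec_eq_iff M)
  have linM: "linear ((*v) M)" by simp
  \<comment> \<open>The complement \<open>W\<close> is not trivial: row \<open>k\<close> of \<open>M\<close> is zero, so \<open>M\<close> is singular.\<close>
  have "\<not> surj ((*v) M)"
  proof
    assume "surj ((*v) M)"
    then obtain v where "axis k 1 = M *v v" by (meson surjD)
    then have "(axis k 1 :: complex^'n) $ k = 0" by (simp add: M insert.hyps)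
    then show False by simp
  qed
  then have "\<not> inj ((*v) M)"
    using linear_injective_imp_surjective[OF linM] by blast
  then have "W \<noteq> {0}"
    using linear_injective_0[OF linM] by (auto simp: W_def)
  moreover have "subspace W"
    unfolding W_def using linear_subspace_kernel[OF linM] .
  moreover have "A *v v \<in> W" if "v \<in> W" for v
  proof -
    have "hermitian_inner (u i) (A *v v) = 0" if "i \<in> S" for i
    proof -
      have "hermitian_inner (u i) (A *v v) = hermitian_inner (complex_of_real (\<mu> i) *s u i) v"
        by (metis adj eig hermitian_inner_adjoint that)
      also have "\<dots> = complex_of_real (\<mu> i) * hermitian_inner (u i) v"
        by (simp add: hermitian_inner_def sum_distrib_left mult_ac)
      finally show ?thesis using \<open>v \<in> W\<close> that by (simp add: W)
    qed
    then show ?thesis by (simp add: W)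
  qed
  then have "(*v) A ` W \<subseteq> W" by blast
  ultimately obtain v \<kappa> where v: "v \<in> W" "norm v = 1" "A *v v = \<kappa> *\<^sub>R v"
    using selfadjoint_invariant_subspace_eigenvector[of "(*v) A" W] inner_adjoint[of A]
    by (metis adj matrix_vector_mul_linear)
  have vv: "hermitian_inner v v = 1"
  proof -
    have "hermitian_inner v v = complex_of_real (\<Sum>i\<in>UNIV. (cmod (v $ i))\<^sup>2)"
      by (simp add: hermitian_inner_def complex_norm_square mult.commute del: of_real_power)
    also have "(\<Sum>i\<in>UNIV. (cmod (v $ i))\<^sup>2) = (norm v)\<^sup>2"
      by (simp add: norm_vec_def L2_set_def sum_nonneg)
    finally show ?thesis using v by simp
  qed
  have uv: "hermitian_inner (u i) v = 0" if "i \<in> S" for i using that v W by simp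
  have vu: "hermitian_inner v (u i) = 0" if "i \<in> S" for i
  proof -
    have "hermitian_inner v (u i) = cnj (hermitian_inner (u i) v)"
      by (simp add: hermitian_inner_def mult.commute)
    then show ?thesis using uv that by simp
  qed
  have vA: "A *v v = complex_of_real \<kappa> *s v"
    unfolding v(3) by (simp add: vec_eq_iff scaleR_conv_of_real[where 'a = complex])
  show ?case
    using eig orth vv uv vu vA insert.hyps
    by (intro exI[of _ "u(k := v)"] exI[of _ "\<mu>(k := \<kappa>)"]) auto
qed simp

lemma hermitian_spectral_decomposition:
  fixes A :: "'n::finite tensor"
  assumes "hermitian_tensor A"
  obtains U \<mu> where "unitary_tensor U" "A = U ** diag_tensor \<mu> ** tensor_adjoint U"
proof -
  obtain u :: "'n \<Rightarrow> complex^'n" and \<mu> where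
    eig: "\<And>i. A *v u i = complex_of_real (\<mu> i) *s u i" and
    orth: "\<And>i j. hermitian_inner (u i) (u j) = (if i = j then 1 else 0)"
    using hermitian_orthonormal_eigenvectors[OF assms, of UNIV] by (metis UNIV_I)
  define U :: "'n tensor" where "U = (\<chi> i j. u j $ i)"
  have "tensor_adjoint U ** U = mat 1"
    using orth
    by (simp add: U_def tensor_adjoint_def matrix_matrix_mult_def hermitian_inner_def mat_def
        vec_eq_iff)
  then have U: "unitary_tensor U"
    using matrix_left_right_inverse unfolding unitary_tensor_def by blast
  have "A ** U = U ** diag_tensor \<mu>"
  proof -
    have "(\<Sum>k\<in>UNIV. A $ i $ k * u j $ k) = complex_of_real (\<mu> j) * u j $ i" for i j
      using arg_cong[OF eig[of j], of "\<lambda>v. v $ i"] by (simp add: matrix_vector_mult_def)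
    then show ?thesis
      by (simp add: U_def diag_tensor_def matrix_matrix_mult_def vec_eq_iff if_distrib
          mult.commute cong: if_cong)
  qed
  then have "A = U ** diag_tensor \<mu> ** tensor_adjoint U"
    by (metis U matrix_mul_assoc matrix_mul_rid unitary_tensor_def)
  with U that show thesis by blast
qed

section \<open>Functional calculus\<close>

text \<open>
  An intertwiner of two diagonal tensors can have a nonzero entry only where the two diagonal
  values agree, and there any function of them agrees too. This is what makes the functional
  calculus independent of the diagonalization.
\<close>

lemma diag_tensor_intertwine:
  fixes W :: "'n::finite tensor"
  assumes "W ** diag_tensor \<mu> = diag_tensor \<nu> ** W"
  shows "W ** diag_tensor (\<lambda>i. f (\<mu> i)) = diag_tensor (\<lambda>i. f (\<nu> i)) ** W"
proof -
  have entries: "(W ** diag_tensor \<alpha>) $ i $ j = W $ i $ j * complex_of_real (\<alpha> j)"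
    "(diag_tensor \<alpha> ** W) $ i $ j = W $ i $ j * complex_of_real (\<alpha> i)" for \<alpha> i j
    by (simp_all add: diag_tensor_def matrix_matrix_mult_def if_distrib if_distribR mult.commute cong: if_cong)
  have "W $ i $ j = 0 \<or> \<mu> j = \<nu> i" for i j
    using arg_cong[OF assms, of "\<lambda>B. B $ i $ j"] by (auto simp: entries)
  then show ?thesis
    unfolding vec_eq_iff entries by (metis mult_zero_left)
qed

text \<open>
  Two diagonalizations of the same tensor by \<open>U\<close> and \<open>V\<close> differ by \<open>V\<^sup>* U\<close>, which
  intertwines the two diagonal parts; hence the value prescribed for \<open>tensor_fun\<close> is unique.
\<close>

lemma tensor_fun_spectral:
  assumes U: "unitary_tensor U"
  shows "tensor_fun f (U ** diag_tensor \<mu> ** tensor_adjoint U)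
    = U ** diag_tensor (\<lambda>i. f (\<mu> i)) ** tensor_adjoint U"
  unfolding tensor_fun_def
proof (rule the_equality)
  fix Y
  assume "\<exists>V \<nu>. unitary_tensor V \<and>
      U ** diag_tensor \<mu> ** tensor_adjoint U = V ** diag_tensor \<nu> ** tensor_adjoint V \<and>
      Y = V ** diag_tensor (\<lambda>i. f (\<nu> i)) ** tensor_adjoint V"
  then obtain V \<nu> where V: "unitary_tensor V"
    and eq: "U ** diag_tensor \<mu> ** tensor_adjoint U = V ** diag_tensor \<nu> ** tensor_adjoint V"
    and Y: "Y = V ** diag_tensor (\<lambda>i. f (\<nu> i)) ** tensor_adjoint V"
    by blast
  define W where "W = tensor_adjoint V ** U"
  note [simp] = U[unfolded unitary_tensor_def] V[unfolded unitary_tensor_def]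
  have VW: "V ** W = U" by (simp add: W_def matrix_mul_assoc)
  have WU: "W ** tensor_adjoint U = tensor_adjoint V"
    by (simp add: W_def flip: matrix_mul_assoc)
  have "W ** diag_tensor \<mu>
      = tensor_adjoint V ** (U ** diag_tensor \<mu> ** tensor_adjoint U) ** U"
    by (simp add: W_def flip: matrix_mul_assoc)
  also have "\<dots> = diag_tensor \<nu> ** W"
    unfolding eq by (simp add: W_def matrix_mul_assoc)
  finally have "W ** diag_tensor (\<lambda>i. f (\<mu> i)) = diag_tensor (\<lambda>i. f (\<nu> i)) ** W"
    by (rule diag_tensor_intertwine)
  then show "Y = U ** diag_tensor (\<lambda>i. f (\<mu> i)) ** tensor_adjoint U"
    unfolding Y by (metis VW WU matrix_mul_assoc)
qed (use U in blast)

lemma diag_tensor_vector: "diag_tensor \<mu> *v z = (\<chi> i. \<mu> i *\<^sub>R z $ i)"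
  by (simp add: diag_tensor_def matrix_vector_mult_def vec_eq_iff if_distrib if_distribR
      scaleR_conv_of_real[where 'a = complex] cong: if_cong)

lemma quadratic_form_spectral:
  "quadratic_form (U ** diag_tensor \<mu> ** tensor_adjoint U) v
    = (\<Sum>i\<in>UNIV. \<mu> i * (cmod ((tensor_adjoint U *v v) $ i))\<^sup>2)"
proof -
  define z where "z = tensor_adjoint U *v v"
  have "quadratic_form (U ** diag_tensor \<mu> ** tensor_adjoint U) v = z \<bullet> (diag_tensor \<mu> *v z)"
    using inner_adjoint[of "tensor_adjoint U" v]
    by (simp add: quadratic_form_def z_def flip: matrix_vector_mul_assoc)
  then show ?thesis
    by (simp add: diag_tensor_vector inner_vec_def z_def power2_norm_eq_inner)
qed

lemma spectral_entry_eigenvalue: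
  assumes U: "unitary_tensor U"
  shows "tensor_eigenvalue (U ** diag_tensor \<mu> ** tensor_adjoint U) (complex_of_real (\<mu> i))"
proof -
  define v where "v = U *v axis i 1"
  have z: "tensor_adjoint U *v v = axis i 1"
    using U by (simp add: v_def matrix_vector_mul_assoc unitary_tensor_def)
  then have "v \<noteq> 0" by auto
  moreover have "diag_tensor \<mu> *v axis i 1 = complex_of_real (\<mu> i) *s axis i 1"
    by (auto simp: diag_tensor_vector vec_eq_iff axis_def scaleR_conv_of_real[where 'a = complex])
  then have "(U ** diag_tensor \<mu> ** tensor_adjoint U) *v v = complex_of_real (\<mu> i) *s v"
    by (simp add: z vector_scalar_commute flip: matrix_vector_mul_assoc) (simp add: v_def)
  ultimately show ?thesis unfolding tensor_eigenvalue_def by blast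
qed

text \<open>
  In the coordinates \<open>U\<^sup>* v\<close> both quadratic forms are sums of squared moduli, weighted with the
  values of \<open>f\<close> and \<open>g\<close> at eigenvalues of \<open>X\<close>.
\<close>

lemma tensor_fun_mono:
  assumes "hermitian_tensor X"
    and "\<And>s. tensor_eigenvalue X (complex_of_real s) \<Longrightarrow> f s \<le> g s"
  shows "tensor_fun f X \<le>\<^sub>L tensor_fun g X"
proof -
  obtain U \<mu> where U: "unitary_tensor U" and X: "X = U ** diag_tensor \<mu> ** tensor_adjoint U"
    using hermitian_spectral_decomposition assms(1) by blast
  have "f (\<mu> i) \<le> g (\<mu> i)" for i
    using assms(2) spectral_entry_eigenvalue[OF U] unfolding X by blast
  then show ?thesis
    unfolding X tensor_fun_spectral[OF U] loewner_le_iff quadratic_form_spectral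
    by (auto intro!: hermitian_congruence_diag sum_mono mult_right_mono)
qed

lemma tensor_fun_affine:
  assumes "hermitian_tensor X"
  shows "tensor_fun (\<lambda>s. m * s + b) X = m *\<^sub>R X + b *\<^sub>R mat 1"
proof -
  obtain U \<mu> where U: "unitary_tensor U" and X: "X = U ** diag_tensor \<mu> ** tensor_adjoint U"
    using hermitian_spectral_decomposition assms by blast
  have D: "diag_tensor (\<lambda>i. m * \<mu> i + b) = m *\<^sub>R diag_tensor \<mu> + b *\<^sub>R mat 1"
    by (auto simp: diag_tensor_def mat_def vec_eq_iff scaleR_conv_of_real[where 'a = complex])
  have scale: "B ** (r *\<^sub>R C) = r *\<^sub>R (B ** C)" "(r *\<^sub>R C) ** B = r *\<^sub>R (C ** B)"
    for B C :: "'a tensor" and r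
    by (simp_all add: matrix_matrix_mult_def vec_eq_iff scaleR_sum_right)
  have add: "(B + C) ** D = B ** D + C ** D" for B C D :: "'a tensor"
    by (simp add: matrix_matrix_mult_def vec_eq_iff sum.distrib distrib_right)
  have "U ** tensor_adjoint U = mat 1" using U by (simp add: unitary_tensor_def)
  then show ?thesis
    unfolding X tensor_fun_spectral[OF U] D
    by (simp add: matrix_add_ldistrib add scale)
qed

lemma hermitian_spectrum_bounds:
  assumes "c *\<^sub>R mat 1 \<le>\<^sub>L A" "A \<le>\<^sub>L d *\<^sub>R mat 1"
    and "tensor_eigenvalue A (complex_of_real s)"
  shows "s \<in> {c..d}"
proof -
  obtain v where v: "v \<noteq> 0" "A *v v = complex_of_real s *s v"
    using assms(3) unfolding tensor_eigenvalue_def by blast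
  have "complex_of_real s *s v = s *\<^sub>R v"
    by (simp add: vec_eq_iff scaleR_conv_of_real[where 'a = complex])
  then have "quadratic_form A v = s * (v \<bullet> v)" using v by (simp add: quadratic_form_def)
  then have "c * (v \<bullet> v) \<le> s * (v \<bullet> v)" "s * (v \<bullet> v) \<le> d * (v \<bullet> v)"
    using assms(1,2) by (auto simp: loewner_le_iff quadratic_form_scaleR quadratic_form_mat_1) (metis)+
  then show ?thesis using v by auto
qed

section \<open>Averages of normalized positive maps\<close>

text \<open>
  Complex homogeneity gives compatibility with real scalars, and normalization turns it into
  compatibility with affine functions.
\<close>

lemma normalized_positive_linear_mapD:
  assumes "normalized_positive_linear_map \<Psi>"
  shows "\<Psi> (m *\<^sub>R Y + b *\<^sub>R mat 1) = m *\<^sub>R \<Psi> Y + b *\<^sub>R mat 1"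
    and "Y \<le>\<^sub>L Z \<Longrightarrow> \<Psi> Y \<le>\<^sub>L \<Psi> Z"
    and "hermitian_tensor Y \<Longrightarrow> hermitian_tensor (\<Psi> Y)"
proof -
  interpret Vector_Spaces.linear tensor_scale tensor_scale \<Psi>
    using assms by (simp add: normalized_positive_linear_map_def)
  have *: "r *\<^sub>R B = tensor_scale (complex_of_real r) B" for r and B :: "'c::finite tensor"
    by (simp add: tensor_scale_def vec_eq_iff scaleR_conv_of_real[where 'a = complex])
  show "\<Psi> (m *\<^sub>R Y + b *\<^sub>R mat 1) = m *\<^sub>R \<Psi> Y + b *\<^sub>R mat 1"
    using assms unfolding * by (simp add: add scale normalized_positive_linear_map_def)
qed (use assms in \<open>auto simp: normalized_positive_linear_map_def\<close>)

section \<open>Chords and tangents of a convex function\<close>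

lemma convex_on_below_chord:
  assumes "c < d" "convex_on {c..d} g" "s \<in> {c..d}"
  shows "g s \<le> chord_slope g c d * s + upper_intercept g c d"
proof -
  have "g s \<le> (g d - g c) / (d - c) * (s - c) + g c"
    using convex_onD_Icc'[OF assms(2,3)] .
  also have "\<dots> = chord_slope g c d * s + upper_intercept g c d"
    using assms(1) by (simp add: chord_slope_def upper_intercept_def divide_simps) algebra
  finally show ?thesis .
qed

text \<open>
  Here \<open>s\<^sub>0\<close> may be an endpoint of \<open>S\<close> with only a one-sided derivative. This generality matters
  because the tangent point picked by \<open>lower_intercept\<close> can be \<open>c\<close> or \<open>d\<close> when \<open>g\<close> is affine.
  Along the segment from \<open>s\<^sub>0\<close> to \<open>s\<close>, convexity bounds every difference quotient by
  \<open>g s - g s\<^sub>0\<close>, and the bound passes to the limit.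
\<close>

lemma convex_on_above_tangent_within:
  fixes g :: "real \<Rightarrow> real"
  assumes conv: "convex_on S g" and "s\<^sub>0 \<in> S" "s \<in> S"
    and der: "(g has_real_derivative D) (at s\<^sub>0 within S)"
  shows "g s\<^sub>0 + D * (s - s\<^sub>0) \<le> g s"
proof -
  define \<gamma> where "\<gamma> t = (1 - t) *\<^sub>R s\<^sub>0 + t *\<^sub>R s" for t
  have \<gamma>: "\<gamma> ` {0..1} \<subseteq> S"
    unfolding \<gamma>_def using assms convex_on_imp_convex[OF conv]
    by (intro image_subsetI convexD_alt) auto
  have "(\<gamma> has_real_derivative (s - s\<^sub>0)) (at 0 within {0..1})"
    unfolding \<gamma>_def by (auto intro!: derivative_eq_intros)
  moreover have "(g has_real_derivative D) (at (\<gamma> 0) within \<gamma> ` {0..1})"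
    using DERIV_subset[OF der \<gamma>] by (simp add: \<gamma>_def)
  ultimately have "((g \<circ> \<gamma>) has_real_derivative D * (s - s\<^sub>0)) (at 0 within {0..1})"
    using DERIV_image_chain by blast
  then have lim: "((\<lambda>t. (g (\<gamma> t) - g s\<^sub>0) / t) \<longlongrightarrow> D * (s - s\<^sub>0)) (at 0 within {0..1})"
    by (simp add: has_field_derivative_iff \<gamma>_def)
  have "(g (\<gamma> t) - g s\<^sub>0) / t \<le> g s - g s\<^sub>0" if "t \<in> {0<..1}" for t
  proof -
    have "g (\<gamma> t) \<le> (1 - t) * g s\<^sub>0 + t * g s"
      unfolding \<gamma>_def using that assms by (intro convex_onD[OF conv]) auto
    then show ?thesis using that by (simp add: field_simps)
  qed
  then have "\<forall>\<^sub>F t in at 0 within {0..1}. (g (\<gamma> t) - g s\<^sub>0) / t \<le> g s - g s\<^sub>0"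
    unfolding eventually_at_filter by (auto intro!: always_eventually)
  moreover have "at 0 within {0..1::real} \<noteq> bot"
    by (simp add: at_within_Icc_at_right trivial_limit_at_right_real)
  ultimately show ?thesis
    using tendsto_upperbound[OF lim] by force
qed

text \<open>
  The mean value theorem puts the chord slope into the range of \<open>g'\<close>, so the point chosen by
  \<open>inv_into\<close> really is a point of tangency, and the line is the tangent there.
\<close>

lemma convex_on_above_lower_intercept:
  assumes "c < d" and conv: "convex_on {c..d} g"
    and der: "\<And>s. s \<in> {c..d} \<Longrightarrow> (g has_real_derivative g' s) (at s within {c..d})"
    and s: "s \<in> {c..d}"
  shows "chord_slope g c d * s + lower_intercept g g' c d \<le> g s"
proof -
  have cont: "continuous_on {c..d} g"
    using der by (intro DERIV_continuous_on) auto
  have "(g has_derivative (*) (g' x)) (at x)" if "c < x" "x < d" for x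
    using der[of x] that
    by (simp add: has_field_derivative_def at_within_Icc_at)
  from mvt[OF \<open>c < d\<close> cont this] obtain \<xi> where "c < \<xi>" "\<xi> < d" "g d - g c = g' \<xi> * (d - c)"
    by blast
  then have slope: "chord_slope g c d \<in> g' ` {c..d}"
    using \<open>c < d\<close> by (intro image_eqI[of _ _ \<xi>]) (auto simp: chord_slope_def)
  define s\<^sub>0 where "s\<^sub>0 = inv_into {c..d} g' (chord_slope g c d)"
  have s0: "s\<^sub>0 \<in> {c..d}" "g' s\<^sub>0 = chord_slope g c d"
    unfolding s\<^sub>0_def using inv_into_into[OF slope] f_inv_into_f[OF slope] by auto
  have "g s\<^sub>0 + g' s\<^sub>0 * (s - s\<^sub>0) \<le> g s"
    using convex_on_above_tangent_within[OF conv s0(1) s der[OF s0(1)]] .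
  then show ?thesis
    by (simp add: s0(2) lower_intercept_def algebra_simps flip: s\<^sub>0_def)
qed

lemma max_on_compact:
  assumes "compact S" "S \<noteq> {}" "continuous_on S f"
  shows "max_on S f \<in> f ` S" and "s \<in> S \<Longrightarrow> f s \<le> max_on S f"
proof -
  obtain x where x: "x \<in> S" "\<And>y. y \<in> S \<Longrightarrow> f y \<le> f x"
    using continuous_attains_sup[OF assms] by blast
  then have "max_on S f = f x"
    unfolding max_on_def by (intro Greatest_equality) auto
  with x show "max_on S f \<in> f ` S" "s \<in> S \<Longrightarrow> f s \<le> max_on S f" by auto
qed

lemma min_on_compact:
  assumes "compact S" "S \<noteq> {}" "continuous_on S f"
  shows "min_on S f \<in> f ` S" and "s \<in> S \<Longrightarrow> min_on S f \<le> f s"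
proof -
  obtain x where x: "x \<in> S" "\<And>y. y \<in> S \<Longrightarrow> f x \<le> f y"
    using continuous_attains_inf[OF assms] by blast
  then have "min_on S f = f x"
    unfolding min_on_def by (intro Least_equality) auto
  with x show "min_on S f \<in> f ` S" "s \<in> S \<Longrightarrow> min_on S f \<le> f s" by auto
qed

section \<open>The ratio bounds\<close>

theorem theorem1:
  fixes c d :: real and l :: nat
    and X :: "nat \<Rightarrow> 'n::finite tensor"
    and \<Psi> :: "nat \<Rightarrow> 'n tensor \<Rightarrow> 'k::finite tensor"
    and w :: "nat \<Rightarrow> real"
    and g g' h :: "real \<Rightarrow> real"
  assumes "c < d" and "l \<ge> 1"
    and "\<And>i. i \<in> {1..l} \<Longrightarrow> hermitian_tensor (X i)"
    and "\<And>i k. i \<in> {1..l} \<Longrightarrow> tensor_eigenvalue (X i) k \<Longrightarrow> k \<in> complex_of_real ` {c..d}"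
    and "\<And>i. i \<in> {1..l} \<Longrightarrow> normalized_positive_linear_map (\<Psi> i)"
    and "\<And>i. i \<in> {1..l} \<Longrightarrow> w i \<ge> 0"
    and "(\<Sum>i=1..l. w i) = 1"
    and "continuous_on {c..d} g" and "continuous_on {c..d} h"
    and "convex_on {c..d} g"
    and "\<And>s. s \<in> {c..d} \<Longrightarrow> (g has_real_derivative g' s) (at s within {c..d})"
    and "\<And>s. s \<in> {c..d} \<Longrightarrow> h s > 0"
    and "\<And>s. s \<in> {c..d} \<Longrightarrow> chord_slope g c d * s + upper_intercept g c d > 0"
    and "\<And>s. s \<in> {c..d} \<Longrightarrow> chord_slope g c d * s + lower_intercept g g' c d > 0"
  shows "(1 / max_on {c..d} (\<lambda>s. (chord_slope g c d * s + upper_intercept g c d) / h s))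
           *\<^sub>R (\<Sum>i=1..l. w i *\<^sub>R \<Psi> i (tensor_fun g (X i)))
         \<le>\<^sub>L tensor_fun h (\<Sum>i=1..l. w i *\<^sub>R \<Psi> i (X i)) \<and>
         tensor_fun h (\<Sum>i=1..l. w i *\<^sub>R \<Psi> i (X i))
         \<le>\<^sub>L (1 / min_on {c..d} (\<lambda>s. (chord_slope g c d * s + lower_intercept g g' c d) / h s))
              *\<^sub>R (\<Sum>i=1..l. w i *\<^sub>R \<Psi> i (tensor_fun g (X i)))"
proof -
  define A where "A = (\<Sum>i=1..l. w i *\<^sub>R \<Psi> i (X i))"
  define G where "G = (\<Sum>i=1..l. w i *\<^sub>R \<Psi> i (tensor_fun g (X i)))"
  define M where "M = max_on {c..d} (\<lambda>s. (chord_slope g c d * s + upper_intercept g c d) / h s)"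
  define N where "N = min_on {c..d} (\<lambda>s. (chord_slope g c d * s + lower_intercept g g' c d) / h s)"
  let ?m = "chord_slope g c d" and ?U = "upper_intercept g c d" and ?L = "lower_intercept g g' c d"
  have mono: "(\<Sum>i=1..l. w i *\<^sub>R \<Psi> i (tensor_fun p (X i)))
        \<le>\<^sub>L (\<Sum>i=1..l. w i *\<^sub>R \<Psi> i (tensor_fun q (X i)))"
    if "\<And>s. s \<in> {c..d} \<Longrightarrow> p s \<le> q s" for p q
  proof (intro loewner_le_sum loewner_le_scaleR)
    fix i assume i: "i \<in> {1..l}"
    show "\<Psi> i (tensor_fun p (X i)) \<le>\<^sub>L \<Psi> i (tensor_fun q (X i))"
    proof (rule normalized_positive_linear_mapD(2)[OF assms(5)[OF i]], rule tensor_fun_mono)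
      show "p s \<le> q s" if "tensor_eigenvalue (X i) (complex_of_real s)" for s
        using assms(4)[OF i that] \<open>\<And>s. s \<in> {c..d} \<Longrightarrow> p s \<le> q s\<close> by auto
    qed (rule assms(3)[OF i])
  qed (use assms(6) in auto)
  have affine: "(\<Sum>i=1..l. w i *\<^sub>R \<Psi> i (tensor_fun (\<lambda>s. m * s + b) (X i)))
      = m *\<^sub>R A + b *\<^sub>R mat 1" for m b
  proof -
    have "(\<Sum>i=1..l. w i *\<^sub>R \<Psi> i (tensor_fun (\<lambda>s. m * s + b) (X i)))
        = (\<Sum>i=1..l. m *\<^sub>R (w i *\<^sub>R \<Psi> i (X i)) + w i *\<^sub>R (b *\<^sub>R mat 1))"
      using assms(3,5)
      by (intro sum.cong) (auto simp: tensor_fun_affine normalized_positive_linear_mapD(1) scaleR_add_right)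
    also have "\<dots> = m *\<^sub>R A + b *\<^sub>R mat 1"
      unfolding A_def sum.distrib scaleR_sum_right[symmetric] scaleR_sum_left[symmetric] assms(7)
      by simp
    finally show ?thesis .
  qed
  have hA: "hermitian_tensor A"
    unfolding A_def
    by (intro hermitian_sum hermitian_scaleR) (rule normalized_positive_linear_mapD(3)[OF assms(5) assms(3)])
  \<comment> \<open>The constants \<open>c\<close>, \<open>d\<close> and the identity are affine functions, so \<open>mono\<close> and \<open>affine\<close> bound \<open>A\<close>.\<close>
  have spec: "s \<in> {c..d}" if "tensor_eigenvalue A (complex_of_real s)" for s
  proof (rule hermitian_spectrum_bounds[OF _ _ that])
    show "c *\<^sub>R mat 1 \<le>\<^sub>L A"
      using mono[of "\<lambda>s. 0 * s + c" "\<lambda>s. 1 * s + 0"] unfolding affine by simp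
    show "A \<le>\<^sub>L d *\<^sub>R mat 1"
      using mono[of "\<lambda>s. 1 * s + 0" "\<lambda>s. 0 * s + d"] unfolding affine by simp
  qed
  have cont: "continuous_on {c..d} (\<lambda>s. (m * s + b) / h s)" for m b
    using assms(9,12) by (intro continuous_intros) fastforce+
  have cd: "compact {c..d}" "{c..d} \<noteq> {}" using assms(1) by auto
  have "M > 0"
    using max_on_compact(1)[OF cd cont, of ?m ?U] assms(12,13) by (auto simp: M_def)
  have "N > 0"
    using min_on_compact(1)[OF cd cont, of ?m ?L] assms(12,14) by (auto simp: N_def)
  have up: "(?m * s + ?U) / M \<le> h s" if "s \<in> {c..d}" for s
    using max_on_compact(2)[OF cd cont that, of ?m ?U, folded M_def] assms(12)[OF that] \<open>M > 0\<close>
    by (simp add: divide_simps mult.commute)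
  have lo: "h s \<le> (?m * s + ?L) / N" if "s \<in> {c..d}" for s
    using min_on_compact(2)[OF cd cont that, of ?m ?L, folded N_def] assms(12)[OF that] \<open>N > 0\<close>
    by (simp add: divide_simps mult.commute)
  have div: "(1 / r) *\<^sub>R (m *\<^sub>R A + b *\<^sub>R mat 1) = tensor_fun (\<lambda>s. (m * s + b) / r) A" for m b r
    using tensor_fun_affine[OF hA, of "m / r" "b / r"]
    by (simp add: scaleR_add_right add_divide_distrib)
  have "G \<le>\<^sub>L ?m *\<^sub>R A + ?U *\<^sub>R mat 1"
    unfolding G_def affine[symmetric]
    by (rule mono) (rule convex_on_below_chord[OF assms(1,10)])
  then have "(1 / M) *\<^sub>R G \<le>\<^sub>L tensor_fun (\<lambda>s. (?m * s + ?U) / M) A"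
    using \<open>M > 0\<close> unfolding div[symmetric] by (intro loewner_le_scaleR) auto
  moreover have "tensor_fun (\<lambda>s. (?m * s + ?U) / M) A \<le>\<^sub>L tensor_fun h A"
    using up spec by (intro tensor_fun_mono hA) blast
  ultimately have 1: "(1 / M) *\<^sub>R G \<le>\<^sub>L tensor_fun h A" by (rule loewner_le_trans)
  have "?m *\<^sub>R A + ?L *\<^sub>R mat 1 \<le>\<^sub>L G"
    unfolding G_def affine[symmetric]
    by (rule mono) (rule convex_on_above_lower_intercept[OF assms(1,10,11)])
  then have "tensor_fun (\<lambda>s. (?m * s + ?L) / N) A \<le>\<^sub>L (1 / N) *\<^sub>R G"
    using \<open>N > 0\<close> unfolding div[symmetric] by (intro loewner_le_scaleR) auto
  moreover have "tensor_fun h A \<le>\<^sub>L tensor_fun (\<lambda>s. (?m * s + ?L) / N) A"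
    using lo spec by (intro tensor_fun_mono hA) blast
  ultimately have 2: "tensor_fun h A \<le>\<^sub>L (1 / N) *\<^sub>R G" using loewner_le_trans by blast
  from 1 2 show ?thesis unfolding A_def G_def M_def N_def by blast
qed

end
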